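(* Let $\mathcal{U},\mathcal{V}$ be real Hilbert spaces and $b:\mathcal{U}\times\mathcal{V}\to\mathbb{R}$ a bilinear form satisfying Assumption 1 with constants $M,\gamma$, let $\mathcal{U}_h\subseteq\mathcal{U}$ and $\mathcal{V}_r\subseteq\mathcal{V}$ be finite-dimensional subspaces satisfying Assumption 3, and let $\ell\in\mathrm{Range}(\mathcal{B})$, $G\in\mathcal{U}'$. Let $\boldsymbol{u}^\star\in\mathcal{U}$ satisfy $b(\boldsymbol{u}^\star,\boldsymbol{v})=\ell(\boldsymbol{v})$ for all $\boldsymbol{v}\in\mathcal{V}$ and let $\boldsymbol{v}^\star\in\mathcal{V}$ satisfy $b(\boldsymbol{u},\boldsymbol{v}^\star)=G(\boldsymbol{u})$ for all $\boldsymbol{u}\in\mathcal{U}$. Let $\boldsymbol{u}_{h,r}\in\mathcal{U}_h$ solve $b(\boldsymbol{u}_{h,r},\Theta_r\boldsymbol{w}_h)=\ell(\Theta_r\boldsymbol{w}_h)$ for all $\boldsymbol{w}_h\in\mathcal{U}_h$, and let $\boldsymbol{v}_{h,r}=\Theta_r\boldsymbol{\omega}_{h,r}$, where $\boldsymbol{\omega}_{h,r}\in\mathcal{U}_h$ solves $b(\boldsymbol{u}_h,\Theta_r\boldsymbol{\omega}_{h,r})=G(\boldsymbol{u}_h)$ for all $\boldsymbol{u}_h\in\mathcal{U}_h$. Define $e_{\mathrm{QoI}}=b(\boldsymbol{u}^\star-\boldsymbol{u}_{h,r},\boldsymbol{v}^\star-\boldsymbol{v}_{h,r})$. Then $$|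e_{\mathrm{QoI}}|\le\gamma^{-1}\|\mathcal{B}\boldsymbol{u}_{h,r}-\ell\|_{\mathcal{V}'}\,\|\mathcal{B}'\boldsymbol{v}_{h,r}-G\|_{\mathcal{U}'}.$$
   Context: Infima and suprema of quotients are over nonzero elements. Assumption 1: $\sup_{\boldsymbol{u}\in\mathcal{U}}\sup_{\boldsymbol{v}\in\mathcal{V}}\frac{b(\boldsymbol{u},\boldsymbol{v})}{\|\boldsymbol{u}\|_{\mathcal{U}}\|\boldsymbol{v}\|_{\mathcal{V}}}=M<\infty$ and $\inf_{\boldsymbol{u}\in\mathcal{U}}\sup_{\boldsymbol{v}\in\mathcal{V}}\frac{b(\boldsymbol{u},\boldsymbol{v})}{\|\boldsymbol{u}\|_{\mathcal{U}}\|\boldsymbol{v}\|_{\mathcal{V}}}=\gamma>0$. The operators $\mathcal{B}:\mathcal{U}\to\mathcal{V}'$ and $\mathcal{B}':\mathcal{V}\to\mathcal{U}'$ are given by $\langle\mathcal{B}\boldsymbol{u},\boldsymbol{v}\rangle=\langle\boldsymbol{u},\mathcal{B}'\boldsymbol{v}\rangle=b(\boldsymbol{u},\boldsymbol{v})$; $\|\cdot\|_{\mathcal{V}'}$, $\|\cdot\|_{\mathcal{U}'}$ are the usual dual norms. Assumption 3: there is a bounded linear operator $\Pi_r:\mathcal{V}\to\mathcal{V}_r$ with $b(\boldsymbol{u}_h,\boldsymbol{v}-\Pi_r\boldsymbol{v})=0$ for all $\boldsymbol{u}_h\in\mathcal{U}_h$, $\boldsymbol{v}\in\mathcal{V}$.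 (Under Assumptions 1 and 3 the two discrete problems have unique solutions.) The operator $\Theta_r:\mathcal{U}_h\to\mathcal{V}_r$ is defined by $(\Theta_r\boldsymbol{w}_h,\boldsymbol{v}_r)_{\mathcal{V}}=b(\boldsymbol{w}_h,\boldsymbol{v}_r)$ for all $\boldsymbol{w}_h\in\mathcal{U}_h$, $\boldsymbol{v}_r\in\mathcal{V}_r$. *)

theory Defs
  imports "HOL-Analysis.Analysis"
begin

text \<open>
  Continuous duals are the types \<open>'a \<Rightarrow>\<^sub>L real\<close>, whose norm is the usual dual norm. Real Hilbert
  spaces are types of sort \<open>{real_inner, complete_space}\<close>.
\<close>

text \<open>
  The supremum and infimum are taken in \<open>ereal\<close> and equated with real constants, so that they are
  genuine (a supremum in \<open>real\<close> would be an arbitrary number for an unbounded family). This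
  excludes trivial spaces, where they are empty and thus infinite.
\<close>
definition inf_sup_bounds ::
    "('u::real_normed_vector \<Rightarrow> 'v::real_normed_vector \<Rightarrow> real) \<Rightarrow> real \<Rightarrow> real \<Rightarrow> bool" where
  "inf_sup_bounds b M \<gamma> \<longleftrightarrow>
     (SUP u\<in>-{0}. SUP v\<in>-{0}. ereal (b u v / (norm u * norm v))) = ereal M \<and>
     (INF u\<in>-{0}. SUP v\<in>-{0}. ereal (b u v / (norm u * norm v))) = ereal \<gamma> \<and>
     \<gamma> > 0"

text \<open>\<^const>\<open>Blinfun\<close> is meaningful only on bounded linear maps; see the lemmas below.\<close>
definition form_op :: "('u::real_normed_vector \<Rightarrow> 'v::real_normed_vector \<Rightarrow> real) \<Rightarrow> 'u \<Rightarrow> ('v \<Rightarrow>\<^sub>L real)" where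
  "form_op b u = Blinfun (\<lambda>v. b u v)"

definition form_op' :: "('u::real_normed_vector \<Rightarrow> 'v::real_normed_vector \<Rightarrow> real) \<Rightarrow> 'v \<Rightarrow> ('u \<Rightarrow>\<^sub>L real)" where
  "form_op' b v = Blinfun (\<lambda>u. b u v)"

definition finite_dim_subspace :: "'a::real_vector set \<Rightarrow> bool" where
  "finite_dim_subspace S \<longleftrightarrow> subspace S \<and> (\<exists>B. finite B \<and> span B = S)"

definition fortin_operator ::
    "('u \<Rightarrow> 'v::real_normed_vector \<Rightarrow> real) \<Rightarrow> 'u set \<Rightarrow> 'v set \<Rightarrow> ('v \<Rightarrow> 'v) \<Rightarrow> bool" where
  "fortin_operator b Uh Vr P \<longleftrightarrow>
     bounded_linear P \<and> range P \<subseteq> Vr \<and> (\<forall>uh\<in>Uh. \<forall>v. b uh (v - P v) = 0)"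

text \<open>Well defined for finite-dimensional \<open>Vr\<close>; see the last lemma below.\<close>
definition Theta :: "('u \<Rightarrow> 'v::real_inner \<Rightarrow> real) \<Rightarrow> 'v set \<Rightarrow> 'u \<Rightarrow> 'v" where
  "Theta b Vr w = (THE r. r \<in> Vr \<and> (\<forall>v\<in>Vr. r \<bullet> v = b w v))"

lemma inf_sup_bounds_le:
  assumes b: "bilinear b" and bd: "inf_sup_bounds b M \<gamma>"
  shows "\<bar>b u v\<bar> \<le> M * norm u * norm v"
proof -
  have zero: "b 0 y = 0" "b x 0 = 0" for x y
    using bilinear_lzero[OF b] bilinear_rzero[OF b] by auto
  have *: "b u w \<le> M * norm u * norm w" for w
  proof (cases "u = 0 \<or> w = 0")
    case True
    then show ?thesis using zero by auto
  next
    case False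
    have "ereal (b u w / (norm u * norm w)) \<le> (SUP v\<in>-{0}. ereal (b u v / (norm u * norm v)))"
      using False by (intro SUP_upper) auto
    also have "\<dots> \<le> (SUP u\<in>-{0}. SUP v\<in>-{0}. ereal (b u v / (norm u * norm v)))"
      using False by (intro SUP_upper) auto
    also have "\<dots> = ereal M" using bd by (simp add: inf_sup_bounds_def)
    finally have "b u w / (norm u * norm w) \<le> M" by simp
    then show ?thesis using False by (simp add: field_simps)
  qed
  show ?thesis using *[of v] *[of "-v"] bilinear_rneg[OF b, of u v] by (simp add: abs_le_iff)
qed

lemma form_op_apply:
  assumes b: "bilinear b" and bd: "inf_sup_bounds b M \<gamma>"
  shows "blinfun_apply (form_op b u) v = b u v"
proof -
  have "bounded_linear (\<lambda>v. b u v)"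
    using b inf_sup_bounds_le[OF b bd, of u]
    by (auto simp: bilinear_def bounded_linear_def bounded_linear_axioms_def mult_ac
        intro!: exI[of _ "M * norm u"])
  then show ?thesis by (simp add: form_op_def bounded_linear_Blinfun_apply)
qed

lemma form_op'_apply:
  assumes b: "bilinear b" and bd: "inf_sup_bounds b M \<gamma>"
  shows "blinfun_apply (form_op' b v) u = b u v"
proof -
  have "bounded_linear (\<lambda>u. b u v)"
    using b inf_sup_bounds_le[OF b bd, of _ v]
    by (auto simp: bilinear_def bounded_linear_def bounded_linear_axioms_def mult_ac
        intro!: exI[of _ "M * norm v"])
  then show ?thesis by (simp add: form_op'_def bounded_linear_Blinfun_apply)
qed

lemma Theta_welldef:
  assumes b: "bilinear b" and fin: "finite_dim_subspace Vr"
  shows "Theta b Vr w \<in> Vr \<and> (\<forall>v\<in>Vr. Theta b Vr w \<bullet> v = b w v)"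
proof -
  have lin: "linear (b w)" using b by (simp add: bilinear_def)
  obtain B where B: "finite B" "span B = Vr" and sub: "subspace Vr"
    using fin by (auto simp: finite_dim_subspace_def)
  obtain C where C: "finite C" "span C = Vr" "pairwise orthogonal C"
    using basis_orthogonal[OF B(1)] B(2) by auto
  define r where "r = (\<Sum>c\<in>C. (b w c / (c \<bullet> c)) *\<^sub>R c)"
  have rV: "r \<in> Vr"
    unfolding r_def C(2)[symmetric] by (intro span_sum span_scale span_base)
  have on_C: "r \<bullet> d = b w d" if "d \<in> C" for d
  proof -
    have "r \<bullet> d = (\<Sum>c\<in>C. if c = d then b w d else 0)"
      unfolding r_def inner_sum_left
    proof (rule sum.cong[OF refl])
      fix c assume "c \<in> C"
      show "((b w c / (c \<bullet> c)) *\<^sub>R c) \<bullet> d = (if c = d then b w d else 0)"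
        using C(3) \<open>c \<in> C\<close> \<open>d \<in> C\<close> linear_0[OF lin]
        by (auto simp: pairwise_def orthogonal_def)
    qed
    then show ?thesis using C(1) that by simp
  qed
  have on_V: "r \<bullet> v = b w v" if "v \<in> Vr" for v
    by (rule linear_eq_on_span[of "\<lambda>v. r \<bullet> v" "b w" C])
      (use lin on_C that C(2) in \<open>auto intro: bounded_linear.linear bounded_linear_inner_right\<close>)
  show ?thesis
    unfolding Theta_def
  proof (rule theI[of _ r])
    show "r \<in> Vr \<and> (\<forall>v\<in>Vr. r \<bullet> v = b w v)" using rV on_V by auto
    fix s assume s: "s \<in> Vr \<and> (\<forall>v\<in>Vr. s \<bullet> v = b w v)"
    then have "s - r \<in> Vr" using rV sub by (simp add: subspace_diff)
    then have "(s - r) \<bullet> (s - r) = 0" using s on_V by (simp add: inner_diff_left)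
    then show "s = r" by simp
  qed
qed

end

theory Submission
  imports Defs
begin

text \<open>
  With \<open>e = u\<^sup>\<star> - u\<^sub>h\<^sub>r\<close>, the equation for \<open>v\<^sup>\<star>\<close> turns \<open>b(e, v\<^sup>\<star> - v\<^sub>h\<^sub>r)\<close> into minus the residual
  \<open>\<B>'v\<^sub>h\<^sub>r - G\<close> evaluated at \<open>e\<close>, while the inf-sup condition bounds \<open>\<gamma> \<parallel>e\<parallel>\<close> by
  \<open>\<parallel>\<B>e\<parallel> = \<parallel>\<B>u\<^sub>h\<^sub>r - \<ell>\<parallel>\<close>.
\<close>

text \<open>The infimum bounds from below the inner supremum at the given \<open>u\<close>, and the
  dual norm bounds that supremum from above by \<open>norm (form_op b u) / norm u\<close>.\<close>

lemma inf_sup_bounds_norm_form_op_ge: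
  assumes b: "bilinear b" and bd: "inf_sup_bounds b M \<gamma>"
  shows "\<gamma> * norm u \<le> norm (form_op b u)"
proof (cases "u = 0")
  \<comment> \<open>The infimum ranges over nonzero \<open>u\<close> only; at \<open>u = 0\<close>
    the left side vanishes.\<close>
  case False
  have "ereal \<gamma> = (INF u\<in>-{0}. SUP v\<in>-{0}. ereal (b u v / (norm u * norm v)))"
    using bd by (simp add: inf_sup_bounds_def)
  also have "\<dots> \<le> (SUP v\<in>-{0}. ereal (b u v / (norm u * norm v)))"
    using False by (intro INF_lower) auto
  also have "\<dots> \<le> ereal (norm (form_op b u) / norm u)"
  proof (rule SUP_least)
    fix v :: 'b assume v: "v \<in> -{0}"
    have "b u v \<le> norm (form_op b u) * norm v"
      using norm_blinfun[of "form_op b u" v] by (simp add: form_op_apply[OF b bd])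
    then show "ereal (b u v / (norm u * norm v)) \<le> ereal (norm (form_op b u) / norm u)"
      using v False by (simp add: field_simps)
  qed
  finally show ?thesis using False by (simp add: field_simps)
qed simp

theorem theorem4p5:
  fixes b :: "'u::{real_inner,complete_space} \<Rightarrow> 'v::{real_inner,complete_space} \<Rightarrow> real"
    and M \<gamma> e_QoI :: real
    and Uh :: "'u set" and Vr :: "'v set"
    and l :: "'v \<Rightarrow>\<^sub>L real" and G :: "'u \<Rightarrow>\<^sub>L real"
    and ustar uhr \<omega>hr :: 'u and vstar vhr :: 'v
  assumes bilin: "bilinear b"
    and assumption1: "inf_sup_bounds b M \<gamma>"
    and Uh: "finite_dim_subspace Uh"
    and Vr: "finite_dim_subspace Vr"
    and assumption3: "\<exists>P. fortin_operator b Uh Vr P"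
    and l: "l \<in> range (form_op b)"
    and ustar: "\<forall>v. b ustar v = l v"
    and vstar: "\<forall>u. b u vstar = G u"
    and uhr_in: "uhr \<in> Uh"
    and uhr: "\<forall>wh\<in>Uh. b uhr (Theta b Vr wh) = l (Theta b Vr wh)"
    and \<omega>hr_in: "\<omega>hr \<in> Uh"
    and \<omega>hr: "\<forall>uh\<in>Uh. b uh (Theta b Vr \<omega>hr) = G uh"
    and vhr: "vhr = Theta b Vr \<omega>hr"
    and e_QoI: "e_QoI = b (ustar - uhr) (vstar - vhr)"
  shows "\<bar>e_QoI\<bar> \<le> inverse \<gamma> * norm (form_op b uhr - l) * norm (form_op' b vhr - G)"
proof -
  define e where "e = ustar - uhr"
  note apply_simps = form_op_apply[OF bilin assumption1] form_op'_apply[OF bilin assumption1]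
  have \<gamma>: "\<gamma> > 0" using assumption1 by (simp add: inf_sup_bounds_def)
  \<comment> \<open>Since \<open>ustar\<close> solves the primal problem,
    \<open>form_op b ustar\<close> is \<open>l\<close>; the sign disappears under the norm.\<close>
  have "form_op b e = - (form_op b uhr - l)"
    using ustar by (intro blinfun_eqI)
      (simp add: apply_simps e_def blinfun.bilinear_simps bilinear_lsub[OF bilin])
  then have "\<gamma> * norm e \<le> norm (form_op b uhr - l)"
    using inf_sup_bounds_norm_form_op_ge[OF bilin assumption1, of e] by (simp only: norm_minus_cancel)
  then have e_le: "norm e \<le> inverse \<gamma> * norm (form_op b uhr - l)"
    using \<gamma> by (simp add: field_simps)
  \<comment> \<open>Split \<open>b e (vstar - vhr)\<close>: the first term is \<open>G e\<close>,
    the second \<open>form_op' b vhr\<close> at \<open>e\<close>.\<close>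
  have "e_QoI = - (form_op' b vhr - G) e"
    using vstar by (simp add: e_QoI e_def [symmetric] apply_simps blinfun.bilinear_simps
        bilinear_rsub[OF bilin])
  then have "\<bar>e_QoI\<bar> \<le> norm (form_op' b vhr - G) * norm e"
    using norm_blinfun[of "form_op' b vhr - G" e] by simp
  also have "\<dots> \<le> norm (form_op' b vhr - G) * (inverse \<gamma> * norm (form_op b uhr - l))"
    using e_le by (intro mult_left_mono) auto
  finally show ?thesis by (simp add: mult_ac)
qed

end
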